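(* Let $\mathbf{X}$ be a Banach space, $\mathrm{F}\in\mathcal{F}_{\mathbf{X}}$ and $t,l>0$. Let $\mathrm{Z}$ be a linear operator in $\mathbf{X}$ with domain $\mathcal{D}(\mathrm{Z})\subset\mathcal{D}(\mathrm{F}'(0))$ such that $\mathrm{Z}f=\mathrm{F}'(0)f$ for every $f\in\mathcal{D}(\mathrm{Z})$. If there exists a local solution $f:[0,l)\to\mathcal{D}(\overline{\mathrm{Z}})$ of the system $$f'(s)=\overline{\mathrm{Z}}f(s),\quad s\in[0,l),\qquad f(0)=g\in\mathcal{D}(\overline{\mathrm{Z}}),$$ then this solution is unique and $$f(s)=w\text{-}\lim_{n\to\infty}\{\mathrm{F}(t/n)\}^{[ns/t]}g,\qquad s\in[0,l).$$
   Context: $\mathcal{L}(\mathbf{X})$ is the space of bounded linear operators on the Banach space $\mathbf{X}$ (over $\mathbb{R}$ or $\mathbb{C}$). For $\mathrm{S}:[0,\infty)\to\mathcal{L}(\mathbf{X})$, the (strong) derivative at $0$ is the linear operator $\mathrm{S}'(0)\psi=\lim_{h\to 0}h^{-1}(\mathrm{S}(h)\psi-\mathrm{S}(0)\psi)$ (norm limit, $h>0$), whose domain $\mathcal{D}(\mathrm{S}'(0))$ is the set of all $\psi\in\mathbf{X}$ for which the limit exists. $\mathcal{F}_{\mathbf{X}}$ is the set of all functions $\mathrm{F}:[0,\infty)\to\mathcal{L}(\mathbf{X})$ such that (i) $\mathrm{F}(0)=\mathrm{I}$ and there exist $M\ge 1$, $a\in\mathbb{R}$ with $\|\mathrm{F}(s/n)^m\|\le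 M\exp(\frac{am}{n}s)$ for all $n,m\in\mathbb{N}$, $s\ge 0$; (ii) $\mathcal{D}(\mathrm{F}'(0))$ is dense in $\mathbf{X}$. Under the stated assumptions $\mathrm{Z}$ is closable (this is a separate result), and $\overline{\mathrm{Z}}$ denotes its closure. The derivative $f'$ is in the norm of $\mathbf{X}$ (one-sided at $s=0$). $[x]$ is the integer part of $x$; $w\text{-}\lim$ is the limit in the weak topology $\sigma(\mathbf{X},\mathbf{X}^* )$. *)

theory Defs
  imports "HOL-Analysis.Analysis"
begin

text \<open>
  Banach spaces over the real or the complex numbers are treated uniformly. The class
  \<^class>\<open>banach\<close> supplies the underlying real Banach space, and \<open>smul\<close> is the
  multiplication by scalars from a field of class \<^class>\<open>real_normed_field\<close>. The types
  \<^typ>\<open>real\<close> and \<^typ>\<open>complex\<close> are instances of that class; since its norm is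
  multiplicative, Gelfand-Mazur shows that up to isomorphism there are no others.
\<close>

locale banach_space_over = vector_space smul
  for smul :: "'k::real_normed_field \<Rightarrow> 'a::banach \<Rightarrow> 'a" +
  assumes norm_scale: "norm (smul c x) = norm c * norm x"
    and scale_of_real: "smul (of_real r) x = r *\<^sub>R x"

lemma banach_space_over_scaleR: "banach_space_over ((*\<^sub>R) :: real \<Rightarrow> 'a::banach \<Rightarrow> 'a)"
  by unfold_locales (auto simp: algebra_simps)

definition bounded_operator ::
    "('k::real_normed_field \<Rightarrow> 'a::real_normed_vector \<Rightarrow> 'a) \<Rightarrow>
     ('k \<Rightarrow> 'b::real_normed_vector \<Rightarrow> 'b) \<Rightarrow> ('a \<Rightarrow> 'b) \<Rightarrow> bool" where
  "bounded_operator s1 s2 T \<longleftrightarrow>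
     Vector_Spaces.linear s1 s2 T \<and> (\<exists>B. \<forall>x. norm (T x) \<le> B * norm x)"

text \<open>
  An operator that need not be everywhere defined is given by its domain \<open>D\<close> and a total
  function \<open>Z\<close>, whose values outside \<open>D\<close> are irrelevant.
\<close>

definition linear_operator_on ::
    "('k::field \<Rightarrow> 'a::ab_group_add \<Rightarrow> 'a) \<Rightarrow> 'a set \<Rightarrow> ('a \<Rightarrow> 'a) \<Rightarrow> bool" where
  "linear_operator_on smul D Z \<longleftrightarrow>
     module.subspace smul D \<and>
     (\<forall>x\<in>D. \<forall>y\<in>D. Z (x + y) = Z x + Z y) \<and>
     (\<forall>c. \<forall>x\<in>D. Z (smul c x) = smul c (Z x))"

definition op_graph :: "'a set \<Rightarrow> ('a \<Rightarrow> 'a) \<Rightarrow> ('a \<times> 'a) set" where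
  "op_graph D Z = {(x, Z x) |x. x \<in> D}"

text \<open>
  The closure of an operator is the operator whose graph is the closure of the given graph.
  The description operator below is well defined exactly for closable operators.
\<close>

definition op_closure_dom :: "'a::topological_space set \<Rightarrow> ('a \<Rightarrow> 'a) \<Rightarrow> 'a set" where
  "op_closure_dom D Z = Domain (closure (op_graph D Z))"

definition op_closure :: "'a::topological_space set \<Rightarrow> ('a \<Rightarrow> 'a) \<Rightarrow> 'a \<Rightarrow> 'a" where
  "op_closure D Z x = (THE y. (x, y) \<in> closure (op_graph D Z))"

text \<open>
  Operator families on \<open>[0, \<infinity>)\<close> are total functions on \<^typ>\<open>real\<close>; only their values at
  nonnegative arguments are ever used.
\<close>

definition deriv0_dom :: "(real \<Rightarrow> 'a \<Rightarrow> 'a::real_normed_vector) \<Rightarrow> 'a set" where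
  "deriv0_dom S = {\<psi>. \<exists>L. ((\<lambda>h. (1 / h) *\<^sub>R (S h \<psi> - S 0 \<psi>)) \<longlongrightarrow> L) (at_right 0)}"

definition deriv0 :: "(real \<Rightarrow> 'a \<Rightarrow> 'a::real_normed_vector) \<Rightarrow> 'a \<Rightarrow> 'a" where
  "deriv0 S \<psi> = Lim (at_right 0) (\<lambda>h. (1 / h) *\<^sub>R (S h \<psi> - S 0 \<psi>))"

definition class_F ::
    "('k::real_normed_field \<Rightarrow> 'a::banach \<Rightarrow> 'a) \<Rightarrow> (real \<Rightarrow> 'a \<Rightarrow> 'a) set" where
  "class_F smul = {F.
     (\<forall>s\<ge>0. bounded_operator smul smul (F s)) \<and>
     F 0 = id \<and>
     (\<exists>M a. M \<ge> 1 \<and> (\<forall>n m s. n \<ge> 1 \<and> m \<ge> 1 \<and> s \<ge> 0 \<longrightarrow>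
        onorm (F (s / real n) ^^ m) \<le> M * exp (a * real m / real n * s))) \<and>
     closure (deriv0_dom F) = UNIV}"

text \<open>
  The derivative within \<open>[0, l)\<close> is the ordinary one at interior points and one-sided at \<open>0\<close>.
\<close>

definition local_solution ::
    "'a::real_normed_vector set \<Rightarrow> ('a \<Rightarrow> 'a) \<Rightarrow> real \<Rightarrow> 'a \<Rightarrow> (real \<Rightarrow> 'a) \<Rightarrow> bool" where
  "local_solution D A l g f \<longleftrightarrow>
     (\<forall>s\<in>{0..<l}. f s \<in> D \<and> (f has_vector_derivative A (f s)) (at s within {0..<l})) \<and>
     f 0 = g"

text \<open>
  The weak topology is the initial topology of the dual space, i.e. of the bounded
  scalar-linear functionals.
\<close>

definition weak_topology ::
    "('k::real_normed_field \<Rightarrow> 'a::real_normed_vector \<Rightarrow> 'a) \<Rightarrow> 'a topology" where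
  "weak_topology smul =
     topology_generated_by {\<phi> -` U |\<phi> U. bounded_operator smul ((*) :: 'k \<Rightarrow> 'k \<Rightarrow> 'k) \<phi> \<and> open U}"

end

theory Submission
  imports Defs
begin

text \<open>
  Put \<open>T\<^sub>n = F (t/n)\<close> and \<open>\<tau>\<^sub>n = t/n\<close>. For \<open>(x, y)\<close> in the closure of the graph of \<open>Z\<close>, stability of
  the powers of \<open>T\<^sub>n\<close> and a telescoping sum give \<open>T\<^sub>n\<^sup>k x = x + k \<tau>\<^sub>n y + o(k \<tau>\<^sub>n) + o\<^sub>n(1)\<close>. In
  particular \<open>y\<close> is determined by \<open>x\<close>, so \<open>Z\<close> is closable. If \<open>f\<close> is a solution, it follows that
  \<open>r \<mapsto> T\<^sub>n\<close> to the power \<open>[(s - r)/\<tau>\<^sub>n]\<close> applied to \<open>f r\<close> has derivative zero on \<open>[0, s]\<close>,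
  asymptotically as \<open>n \<rightarrow> \<infinity>\<close>; a Bolzano (covering) argument therefore shows that its values at
  \<open>0\<close> and at \<open>s\<close> agree in the limit. The convergence obtained is in norm, and uniqueness of
  the solution is uniqueness of limits.
\<close>

section \<open>Stable and consistent one-step schemes\<close>

definition consistent_graph ::
    "(nat \<Rightarrow> 'a \<Rightarrow> 'a::real_normed_vector) \<Rightarrow> (nat \<Rightarrow> real) \<Rightarrow> ('a \<times> 'a) set" where
  "consistent_graph T \<tau> =
     {(x, y). \<forall>\<epsilon>>0. \<forall>\<^sub>F n in sequentially. norm (T n x - x - \<tau> n *\<^sub>R y) \<le> \<epsilon> * \<tau> n}"

locale stable_scheme =
  fixes T :: "nat \<Rightarrow> 'a \<Rightarrow> 'a::real_normed_vector" and \<tau> :: "nat \<Rightarrow> real"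
  assumes linear_T: "linear (T n)"
    and step_nonneg: "\<tau> n \<ge> 0"
    and step_pos: "\<forall>\<^sub>F n in sequentially. \<tau> n > 0"
    and step_tendsto: "\<tau> \<longlonglongrightarrow> 0"
    and stable: "\<exists>C\<ge>1. \<forall>n k x. real k * \<tau> n \<le> B \<longrightarrow> norm ((T n ^^ k) x) \<le> C * norm x"
    and dense: "closure (Domain (consistent_graph T \<tau>)) = UNIV"
begin

section \<open>Short-time expansion of the powers\<close>

lemma linear_power: "linear (T n ^^ k)"
proof (induction k)
  case 0
  show ?case unfolding funpow.simps by (rule linear_id)
next
  case (Suc k)
  then show ?case
    unfolding funpow.simps by (intro linear_compose[OF _ linear_T])
qed

text \<open>Telescoping: \<open>(T n ^^ k) x - x\<close> is the sum of the increments
  \<open>(T n ^^ i) (T n x - x)\<close>, each compared with \<open>\<tau> n *\<^sub>R y\<close>. The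
  first sum collects propagated one-step defects, to be bounded by stability; the second is the
  drift of \<open>y\<close>, to be bounded by \<open>near_identity\<close>. With
  \<open>y = 0\<close> only the bare telescoping sum remains.\<close>

lemma power_expansion:
  "(T n ^^ k) x - x - (real k * \<tau> n) *\<^sub>R y =
     (\<Sum>i<k. (T n ^^ i) (T n x - x - \<tau> n *\<^sub>R y)) + \<tau> n *\<^sub>R (\<Sum>i<k. (T n ^^ i) y - y)"
proof (induction k)
  case 0
  then show ?case by simp
next
  case (Suc k)
  have "(T n ^^ Suc k) x = (T n ^^ k) (T n x)"
    by (simp add: funpow_swap1)
  moreover have "(T n ^^ k) (T n x - x - \<tau> n *\<^sub>R y) =
      (T n ^^ k) (T n x) - (T n ^^ k) x - \<tau> n *\<^sub>R (T n ^^ k) y"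
    by (simp add: linear_diff[OF linear_power] linear_cmul[OF linear_power])
  ultimately show ?case
    using Suc.IH by (simp add: algebra_simps del: funpow.simps)
qed

lemma sum_power_bound:
  assumes "\<And>i. i < k \<Longrightarrow> norm (v i) \<le> c"
  shows "norm (\<Sum>i<k. v i) \<le> real k * c"
  using sum_norm_le[of "{..<k}" v "\<lambda>_. c"] assms by simp

text \<open>Strong continuity at time zero, uniform in large \<open>n\<close>. On the domain of the
  consistent graph each step moves a vector by O(\<open>\<tau> n\<close>), and stability makes such
  moves add up to O(\<open>k * \<tau> n\<close>). Density and stability extend this to all
  \<open>z\<close>.\<close>

lemma near_identity:
  assumes "\<epsilon> > 0"
  shows "\<exists>\<delta>>0. \<forall>\<^sub>F n in sequentially. \<forall>k. real k * \<tau> n \<le> \<delta> \<longrightarrow> norm ((T n ^^ k) z - z) \<le> \<epsilon>"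
proof -
  obtain C where C: "C \<ge> 1" "\<And>n k x. real k * \<tau> n \<le> 1 \<Longrightarrow> norm ((T n ^^ k) x) \<le> C * norm x"
    using stable[of 1] by blast
  have "z \<in> closure (Domain (consistent_graph T \<tau>))"
    using dense by simp
  moreover have "\<epsilon> / (2 * (C + 1)) > 0"
    using assms C by simp
  ultimately obtain z0 y0 where K: "(z0, y0) \<in> consistent_graph T \<tau>"
    and z0: "dist z0 z < \<epsilon> / (2 * (C + 1))"
    unfolding closure_approachable by (metis DomainE)
  \<comment> \<open>The drift of \<open>z0\<close> within time \<open>\<delta>\<close> is at most
    half of \<open>\<epsilon>\<close>; replacing \<open>z\<close> by \<open>z0\<close> costs the
    other half, through the factor \<open>C + 1\<close>. The bound by 1 keeps to the time range in
    which \<open>C\<close> is valid.\<close>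
  define \<delta> where "\<delta> = min 1 (\<epsilon> / (2 * C * (norm y0 + 1)))"
  have pos: "2 * C * (norm y0 + 1) > 0"
    using C by (simp add: add_nonneg_pos)
  then have "\<delta> \<le> \<epsilon> / (2 * C * (norm y0 + 1))" "\<delta> > 0" "\<delta> \<le> 1"
    using assms by (auto simp: \<delta>_def intro: divide_pos_pos)
  with pos have \<delta>: "\<delta> > 0" "\<delta> \<le> 1" "\<delta> * (C * (norm y0 + 1)) \<le> \<epsilon> / 2"
    by (auto simp: pos_le_divide_eq algebra_simps)
  \<comment> \<open>Tolerance 1 suffices, since only the order of magnitude of a step is
    wanted.\<close>
  have "\<forall>\<^sub>F n in sequentially. norm (T n z0 - z0 - \<tau> n *\<^sub>R y0) \<le> 1 * \<tau> n"
    using K unfolding consistent_graph_def by (auto dest: spec[of _ 1])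
  then have "\<forall>\<^sub>F n in sequentially. \<forall>k. real k * \<tau> n \<le> \<delta> \<longrightarrow> norm ((T n ^^ k) z - z) \<le> \<epsilon>"
  proof eventually_elim
    case (elim n)
    show ?case
    proof (intro allI impI)
      fix k assume k: "real k * \<tau> n \<le> \<delta>"
      have i: "real i * \<tau> n \<le> 1" if "i \<le> k" for i
        using that k \<delta>(2) step_nonneg[of n] mult_right_mono[of "real i" "real k" "\<tau> n"] by simp
      have step: "norm (T n z0 - z0) \<le> (norm y0 + 1) * \<tau> n"
        using elim norm_triangle_ineq[of "T n z0 - z0 - \<tau> n *\<^sub>R y0" "\<tau> n *\<^sub>R y0"] step_nonneg[of n]
        by (simp add: algebra_simps)
      have "norm ((T n ^^ k) z0 - z0) = norm (\<Sum>i<k. (T n ^^ i) (T n z0 - z0))"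
        using power_expansion[where n = n and k = k and x = z0 and y = 0]
        by (simp add: linear_0[OF linear_power])
      also have "\<dots> \<le> real k * (C * ((norm y0 + 1) * \<tau> n))"
        using C(1) by (intro sum_power_bound order_trans[OF C(2)[OF i]] mult_left_mono step) auto
      also have "\<dots> = real k * \<tau> n * (C * (norm y0 + 1))"
        by simp
      also have "\<dots> \<le> \<delta> * (C * (norm y0 + 1))"
        using k pos by (intro mult_right_mono) auto
      finally have 1: "norm ((T n ^^ k) z0 - z0) \<le> \<epsilon> / 2"
        using \<delta>(3) by simp
      have "(C + 1) * norm (z - z0) \<le> \<epsilon> / 2"
        using z0 C(1) by (simp add: dist_norm norm_minus_commute field_simps)
      moreover have "norm ((T n ^^ k) (z - z0)) \<le> C * norm (z - z0)"
        using C(2)[OF i] by simp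
      moreover have "(T n ^^ k) z - z = (T n ^^ k) (z - z0) + ((T n ^^ k) z0 - z0) - (z - z0)"
        by (simp add: linear_diff[OF linear_power])
      ultimately show "norm ((T n ^^ k) z - z) \<le> \<epsilon>"
        using 1 norm_triangle_ineq[of "(T n ^^ k) (z - z0)" "(T n ^^ k) z0 - z0"]
          norm_triangle_ineq4[of "(T n ^^ k) (z - z0) + ((T n ^^ k) z0 - z0)" "z - z0"]
        by (simp add: algebra_simps)
    qed
  qed
  with \<delta>(1) show ?thesis by blast
qed

text \<open>An approximating pair in the graph itself differs from \<open>(x, y)\<close> by an error
  that does not shrink with the elapsed time; \<open>\<eta>\<close> pays for it. The radius
  \<open>\<delta>\<close> is chosen before \<open>\<eta>\<close>, so that \<open>\<eta>\<close> can
  later be taken proportional to a time increment below \<open>\<delta>\<close>.\<close>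

lemma first_order:
  assumes xy: "(x, y) \<in> closure (consistent_graph T \<tau>)" and "\<epsilon> > 0"
  shows "\<exists>\<delta>>0. \<forall>\<eta>>0. \<forall>\<^sub>F n in sequentially. \<forall>k. real k * \<tau> n \<le> \<delta> \<longrightarrow>
    norm ((T n ^^ k) x - x - (real k * \<tau> n) *\<^sub>R y) \<le> \<epsilon> * (real k * \<tau> n) + \<eta>"
proof -
  obtain C where C: "C \<ge> 1" "\<And>n k x. real k * \<tau> n \<le> 1 \<Longrightarrow> norm ((T n ^^ k) x) \<le> C * norm x"
    using stable[of 1] by blast
  obtain \<delta>1 where \<delta>1: "\<delta>1 > 0"
    "\<forall>\<^sub>F n in sequentially. \<forall>k. real k * \<tau> n \<le> \<delta>1 \<longrightarrow> norm ((T n ^^ k) y - y) \<le> \<epsilon> / 2"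
    using near_identity[of "\<epsilon> / 2" y] \<open>\<epsilon> > 0\<close> by auto
  have "\<forall>\<^sub>F n in sequentially. \<forall>k. real k * \<tau> n \<le> min \<delta>1 1 \<longrightarrow>
    norm ((T n ^^ k) x - x - (real k * \<tau> n) *\<^sub>R y) \<le> \<epsilon> * (real k * \<tau> n) + \<eta>" if "\<eta> > 0" for \<eta>
  proof -
    \<comment> \<open>The first bound covers \<open>x - x'\<close> together with its image under the
      power. The second covers the propagated defects: one \<open>c\<close> per unit time from the
      consistency of \<open>(x', y')\<close>, another from replacing \<open>y'\<close> by
      \<open>y\<close>.\<close>
    define c where "c = min (\<eta> / (C + 1)) (\<epsilon> / (4 * C))"
    have "c \<le> \<eta> / (C + 1)" "c \<le> \<epsilon> / (4 * C)" "c > 0"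
      using \<open>\<eta> > 0\<close> \<open>\<epsilon> > 0\<close> C(1) by (auto simp: c_def)
    then have c: "c > 0" "(C + 1) * c \<le> \<eta>" "C * (2 * c) \<le> \<epsilon> / 2"
      using C(1) by (auto simp: pos_le_divide_eq algebra_simps)
    obtain x' y' where K: "(x', y') \<in> consistent_graph T \<tau>" and d: "dist (x', y') (x, y) < c"
      using xy c(1) unfolding closure_approachable by (metis surj_pair)
    have x': "norm (x - x') \<le> c" and y': "norm (y - y') \<le> c"
      using d dist_fst_le[of "(x', y')" "(x, y)"] dist_snd_le[of "(x', y')" "(x, y)"]
      by (auto simp: dist_norm norm_minus_commute)
    have "\<forall>\<^sub>F n in sequentially. norm (T n x' - x' - \<tau> n *\<^sub>R y') \<le> c * \<tau> n"
      using K c(1) unfolding consistent_graph_def by auto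
    with \<delta>1(2) show ?thesis
    proof eventually_elim
      case (elim n)
      show ?case
      proof (intro allI impI)
        fix k assume k: "real k * \<tau> n \<le> min \<delta>1 1"
        have i: "real i * \<tau> n \<le> \<delta>1" "real i * \<tau> n \<le> 1" if "i \<le> k" for i
          using that k step_nonneg[of n] mult_right_mono[of "real i" "real k" "\<tau> n"] by auto
        have step: "norm (T n x' - x' - \<tau> n *\<^sub>R y) \<le> 2 * c * \<tau> n"
        proof -
          have "norm (\<tau> n *\<^sub>R (y' - y)) \<le> \<tau> n * c"
            using y' step_nonneg[of n] by (simp add: norm_minus_commute mult_left_mono)
          moreover have "T n x' - x' - \<tau> n *\<^sub>R y = (T n x' - x' - \<tau> n *\<^sub>R y') + \<tau> n *\<^sub>R (y' - y)"
            by (simp add: algebra_simps)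
          ultimately show ?thesis
            using elim(2) norm_triangle_ineq[of "T n x' - x' - \<tau> n *\<^sub>R y'" "\<tau> n *\<^sub>R (y' - y)"]
            by (simp add: algebra_simps)
        qed
        have "norm (\<Sum>i<k. (T n ^^ i) (T n x' - x' - \<tau> n *\<^sub>R y)) \<le> real k * (C * (2 * c * \<tau> n))"
          using C(1) by (intro sum_power_bound order_trans[OF C(2)[OF i(2)]] mult_left_mono step) auto
        also have "\<dots> = C * (2 * c) * (real k * \<tau> n)"
          by simp
        also have "\<dots> \<le> \<epsilon> / 2 * (real k * \<tau> n)"
          using c(3) step_nonneg[of n] by (intro mult_right_mono) auto
        finally have 1: "norm (\<Sum>i<k. (T n ^^ i) (T n x' - x' - \<tau> n *\<^sub>R y)) \<le> \<epsilon> / 2 * (real k * \<tau> n)" .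
        have "norm (\<Sum>i<k. (T n ^^ i) y - y) \<le> real k * (\<epsilon> / 2)"
          using elim(1) i(1) by (intro sum_power_bound) auto
        from mult_left_mono[OF this step_nonneg[of n]]
        have 2: "norm (\<tau> n *\<^sub>R (\<Sum>i<k. (T n ^^ i) y - y)) \<le> \<epsilon> / 2 * (real k * \<tau> n)"
          using step_nonneg[of n] by (simp add: mult_ac)
        have 3: "norm ((T n ^^ k) x' - x' - (real k * \<tau> n) *\<^sub>R y) \<le> \<epsilon> * (real k * \<tau> n)"
          unfolding power_expansion by (rule order_trans[OF norm_triangle_ineq]) (use 1 2 in simp)
        have "norm ((T n ^^ k) (x - x')) \<le> C * norm (x - x')"
          using C(2)[OF i(2)] by simp
        moreover have "(C + 1) * norm (x - x') \<le> (C + 1) * c"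
          using x' C(1) by (intro mult_left_mono) auto
        ultimately have 4: "norm ((T n ^^ k) (x - x') - (x - x')) \<le> \<eta>"
          using norm_triangle_ineq4[of "(T n ^^ k) (x - x')" "x - x'"] c(2)
          by (simp add: algebra_simps)
        have "(T n ^^ k) x - x - (real k * \<tau> n) *\<^sub>R y =
            ((T n ^^ k) x' - x' - (real k * \<tau> n) *\<^sub>R y) + ((T n ^^ k) (x - x') - (x - x'))"
          by (simp add: linear_diff[OF linear_power])
        then show "norm ((T n ^^ k) x - x - (real k * \<tau> n) *\<^sub>R y) \<le> \<epsilon> * (real k * \<tau> n) + \<eta>"
          using norm_triangle_mono[OF 3 4] by presburger
      qed
    qed
  qed
  then show ?thesis
    using \<delta>1(1) by (intro exI[of _ "min \<delta>1 1"]) auto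
qed

section \<open>Local error over a small time increment, and closability\<close>

lemma step_less:
  assumes "c > 0"
  shows "\<forall>\<^sub>F n in sequentially. \<tau> n < c"
  using order_tendstoD(2)[OF step_tendsto assms] .

text \<open>The slack \<open>\<tau> n\<close> in the number of steps absorbs the rounding in a difference of floors.\<close>

lemma local_error:
  assumes xy: "(x, y) \<in> closure (consistent_graph T \<tau>)" and "\<epsilon> > 0"
  shows "\<exists>c>0. \<exists>\<delta>>0. \<forall>h z. 0 < h \<and> h < \<delta> \<longrightarrow>
    (norm (z - x - h *\<^sub>R y) \<le> c * h \<longrightarrow>
      (\<forall>\<^sub>F n in sequentially. \<forall>k. \<bar>real k * \<tau> n - h\<bar> \<le> \<tau> n \<longrightarrow> norm ((T n ^^ k) x - z) \<le> \<epsilon> * h)) \<and>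
    (norm (x - z - h *\<^sub>R y) \<le> c * h \<longrightarrow>
      (\<forall>\<^sub>F n in sequentially. \<forall>k. \<bar>real k * \<tau> n - h\<bar> \<le> \<tau> n \<longrightarrow> norm ((T n ^^ k) z - x) \<le> \<epsilon> * h))"
proof -
  obtain C where C: "C \<ge> 1" "\<And>n k x. real k * \<tau> n \<le> 1 \<Longrightarrow> norm ((T n ^^ k) x) \<le> C * norm x"
    using stable[of 1] by blast
  \<comment> \<open>The backward estimate spends \<open>4 * c * h\<close> on the expansion at
    \<open>x\<close>, \<open>c * h\<close> on the drift of \<open>y\<close>, and
    \<open>C * (c * h)\<close> on the propagated defect of \<open>z\<close>.\<close>
  define c where "c = \<epsilon> / (C + 5)"
  have c: "c > 0" "(C + 5) * c = \<epsilon>"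
    using C(1) \<open>\<epsilon> > 0\<close> by (auto simp: c_def)
  obtain \<delta>1 where \<delta>1: "\<delta>1 > 0"
    "\<And>\<eta>. \<eta> > 0 \<Longrightarrow> \<forall>\<^sub>F n in sequentially. \<forall>k. real k * \<tau> n \<le> \<delta>1 \<longrightarrow>
      norm ((T n ^^ k) x - x - (real k * \<tau> n) *\<^sub>R y) \<le> c * (real k * \<tau> n) + \<eta>"
    using first_order[OF xy c(1)] by blast
  obtain \<delta>2 where \<delta>2: "\<delta>2 > 0"
    "\<forall>\<^sub>F n in sequentially. \<forall>k. real k * \<tau> n \<le> \<delta>2 \<longrightarrow> norm ((T n ^^ k) y - y) \<le> c"
    using near_identity[OF c(1), of y] by blast
  \<comment> \<open>Halved because rounding can raise the elapsed time \<open>k * \<tau> n\<close>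
    above \<open>h\<close>, though for large \<open>n\<close> not above
    \<open>2 * \<delta>\<close>.\<close>
  define \<delta> where "\<delta> = min (min \<delta>1 \<delta>2) 1 / 2"
  have \<delta>: "\<delta> > 0" "2 * \<delta> \<le> \<delta>1" "2 * \<delta> \<le> \<delta>2" "2 * \<delta> \<le> 1"
    using \<delta>1(1) \<delta>2(1) by (auto simp: \<delta>_def)
  have key: "\<forall>\<^sub>F n in sequentially. \<forall>k. \<bar>real k * \<tau> n - h\<bar> \<le> \<tau> n \<longrightarrow>
      norm ((T n ^^ k) x - x - h *\<^sub>R y) \<le> 4 * c * h \<and> norm ((T n ^^ k) y - y) \<le> c \<and> real k * \<tau> n \<le> 1"
    if h: "0 < h" "h < \<delta>" for h
  proof -
    \<comment> \<open>As \<open>h\<close> is fixed before \<open>n\<close>, the slack in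
      \<open>first_order\<close> can be \<open>c * h\<close>. The further smallness condition on
      \<open>\<tau> n\<close> bounds the rounding error \<open>\<tau> n * norm y\<close> by
      \<open>c * h\<close>; adding 1 to the norm covers \<open>y = 0\<close>.\<close>
    have ch: "c * h > 0"
      using c h by simp
    have "c * h / (norm y + 1) > 0"
      using ch by (simp add: add_nonneg_pos)
    from \<delta>1(2)[OF ch] \<delta>2(2) step_less[OF \<delta>(1)] step_less[OF h(1)] step_less[OF this]
    show ?thesis
    proof eventually_elim
      case (elim n)
      show ?case
      proof (intro allI impI)
        fix k assume k: "\<bar>real k * \<tau> n - h\<bar> \<le> \<tau> n"
        then have kd: "real k * \<tau> n \<le> 2 * \<delta>" and kh: "real k * \<tau> n \<le> 2 * h"
          using elim(3,4) h by auto
        have "norm ((T n ^^ k) x - x - (real k * \<tau> n) *\<^sub>R y) \<le> c * (real k * \<tau> n) + c * h"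
          using elim(1) kd \<delta>(2) by auto
        moreover have "c * (real k * \<tau> n) \<le> c * (2 * h)"
          using c(1) kh by (intro mult_left_mono) auto
        ultimately have 1: "norm ((T n ^^ k) x - x - (real k * \<tau> n) *\<^sub>R y) \<le> 3 * c * h"
          by simp
        have "\<bar>real k * \<tau> n - h\<bar> * norm y \<le> \<tau> n * (norm y + 1)"
          using k by (intro mult_mono) auto
        also have "\<dots> \<le> c * h"
          using elim(5) by (simp add: pos_less_divide_eq add_nonneg_pos less_imp_le)
        finally have 2: "norm ((real k * \<tau> n - h) *\<^sub>R y) \<le> c * h"
          by simp
        have "norm ((T n ^^ k) x - x - h *\<^sub>R y) \<le> 4 * c * h"
          using norm_triangle_mono[OF 1 2] by (simp add: algebra_simps)
        then show "norm ((T n ^^ k) x - x - h *\<^sub>R y) \<le> 4 * c * h \<and> norm ((T n ^^ k) y - y) \<le> c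
            \<and> real k * \<tau> n \<le> 1"
          using elim(2) kd \<delta>(3,4) by auto
      qed
    qed
  qed
  have "(norm (z - x - h *\<^sub>R y) \<le> c * h \<longrightarrow>
      (\<forall>\<^sub>F n in sequentially. \<forall>k. \<bar>real k * \<tau> n - h\<bar> \<le> \<tau> n \<longrightarrow> norm ((T n ^^ k) x - z) \<le> \<epsilon> * h)) \<and>
    (norm (x - z - h *\<^sub>R y) \<le> c * h \<longrightarrow>
      (\<forall>\<^sub>F n in sequentially. \<forall>k. \<bar>real k * \<tau> n - h\<bar> \<le> \<tau> n \<longrightarrow> norm ((T n ^^ k) z - x) \<le> \<epsilon> * h))"
    if h: "0 < h" "h < \<delta>" for h z
  proof (intro conjI impI)
    assume z: "norm (z - x - h *\<^sub>R y) \<le> c * h"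
    have "4 * c * h + c * h \<le> \<epsilon> * h"
      unfolding c(2)[symmetric] using C(1) c(1) h by (simp add: algebra_simps)
    then have "norm ((T n ^^ k) x - z) \<le> \<epsilon> * h"
      if "norm ((T n ^^ k) x - x - h *\<^sub>R y) \<le> 4 * c * h" for n k
      using norm_triangle_ineq4[of "(T n ^^ k) x - x - h *\<^sub>R y" "z - x - h *\<^sub>R y"] that z by simp
    with key[OF h] show "\<forall>\<^sub>F n in sequentially. \<forall>k. \<bar>real k * \<tau> n - h\<bar> \<le> \<tau> n \<longrightarrow>
        norm ((T n ^^ k) x - z) \<le> \<epsilon> * h"
      by (elim eventually_mono) blast
  next
    \<comment> \<open>Here \<open>x\<close> is the later point, yet the expansion is available only
      at \<open>x\<close>. So \<open>z\<close> is written as \<open>x - h *\<^sub>R y\<close> minus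
      a defect, and the power is applied to the three terms separately.\<close>
    assume z: "norm (x - z - h *\<^sub>R y) \<le> c * h"
    show "\<forall>\<^sub>F n in sequentially. \<forall>k. \<bar>real k * \<tau> n - h\<bar> \<le> \<tau> n \<longrightarrow> norm ((T n ^^ k) z - x) \<le> \<epsilon> * h"
      using key[OF h]
    proof eventually_elim
      case (elim n)
      show ?case
      proof (intro allI impI)
        fix k assume "\<bar>real k * \<tau> n - h\<bar> \<le> \<tau> n"
        with elim have 1: "norm ((T n ^^ k) x - x - h *\<^sub>R y) \<le> 4 * c * h"
          and "norm ((T n ^^ k) y - y) \<le> c" and "real k * \<tau> n \<le> 1"
          by auto
        then have 2: "norm (h *\<^sub>R ((T n ^^ k) y - y)) \<le> c * h"
          and 3: "norm ((T n ^^ k) (x - z - h *\<^sub>R y)) \<le> C * norm (x - z - h *\<^sub>R y)"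
          using h C(2) by (simp_all add: mult.commute)
        have "C * norm (x - z - h *\<^sub>R y) \<le> C * (c * h)"
          using z C(1) by (intro mult_left_mono) auto
        then have total: "4 * c * h + c * h + norm ((T n ^^ k) (x - z - h *\<^sub>R y)) \<le> \<epsilon> * h"
          unfolding c(2)[symmetric] using 3 by (simp add: algebra_simps)
        have "(T n ^^ k) z - x = ((T n ^^ k) x - x - h *\<^sub>R y)
            - h *\<^sub>R ((T n ^^ k) y - y) - (T n ^^ k) (x - z - h *\<^sub>R y)"
          by (simp add: linear_diff[OF linear_power] linear_cmul[OF linear_power] scaleR_diff_right)
        also have "norm \<dots> \<le> 4 * c * h + c * h + norm ((T n ^^ k) (x - z - h *\<^sub>R y))"
          by (intro order_trans[OF norm_triangle_ineq4] add_mono 1 2 order_refl)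
        also have "\<dots> \<le> \<epsilon> * h"
          by (rule total)
        finally show "norm ((T n ^^ k) z - x) \<le> \<epsilon> * h" .
      qed
    qed
  qed
  with c(1) \<delta>(1) show ?thesis by blast
qed

lemma floor_steps:
  assumes "0 < \<tau> n" "h \<ge> 0"
  shows "real (nat \<lfloor>h / \<tau> n\<rfloor>) * \<tau> n \<le> h" "h < real (nat \<lfloor>h / \<tau> n\<rfloor>) * \<tau> n + \<tau> n"
proof -
  have "real (nat \<lfloor>h / \<tau> n\<rfloor>) \<le> h / \<tau> n" "h / \<tau> n < real (nat \<lfloor>h / \<tau> n\<rfloor>) + 1"
    using assms by (auto simp: of_nat_nat)
  then show "real (nat \<lfloor>h / \<tau> n\<rfloor>) * \<tau> n \<le> h" "h < real (nat \<lfloor>h / \<tau> n\<rfloor>) * \<tau> n + \<tau> n"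
    using assms(1) by (simp_all add: field_simps)
qed

text \<open>Apply \<open>local_error\<close> with the exact first-order points
  \<open>x + h *\<^sub>R y\<close> and \<open>x + h *\<^sub>R z\<close>, whose defect is zero. The
  same iterate of \<open>x\<close> lies within \<open>\<epsilon> / 2 * h\<close> of both; dividing
  by \<open>h\<close> bounds \<open>norm (y - z)\<close> by \<open>\<epsilon>\<close>.\<close>

lemma closable:
  assumes "(x, y) \<in> closure (consistent_graph T \<tau>)" "(x, z) \<in> closure (consistent_graph T \<tau>)"
  shows "y = z"
proof -
  have "norm (y - z) \<le> \<epsilon>" if "\<epsilon> > 0" for \<epsilon>
  proof -
    obtain c1 \<delta>1 where 1: "c1 > 0" "\<delta>1 > 0" "\<And>h w. 0 < h \<Longrightarrow> h < \<delta>1 \<Longrightarrow> norm (w - x - h *\<^sub>R y) \<le> c1 * h \<Longrightarrow>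
        \<forall>\<^sub>F n in sequentially. \<forall>k. \<bar>real k * \<tau> n - h\<bar> \<le> \<tau> n \<longrightarrow> norm ((T n ^^ k) x - w) \<le> \<epsilon> / 2 * h"
      using local_error[OF assms(1), of "\<epsilon> / 2"] \<open>\<epsilon> > 0\<close> by auto
    obtain c2 \<delta>2 where 2: "c2 > 0" "\<delta>2 > 0" "\<And>h w. 0 < h \<Longrightarrow> h < \<delta>2 \<Longrightarrow> norm (w - x - h *\<^sub>R z) \<le> c2 * h \<Longrightarrow>
        \<forall>\<^sub>F n in sequentially. \<forall>k. \<bar>real k * \<tau> n - h\<bar> \<le> \<tau> n \<longrightarrow> norm ((T n ^^ k) x - w) \<le> \<epsilon> / 2 * h"
      using local_error[OF assms(2), of "\<epsilon> / 2"] \<open>\<epsilon> > 0\<close> by auto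
    define h where "h = min \<delta>1 \<delta>2 / 2"
    have h: "0 < h" "h < \<delta>1" "h < \<delta>2"
      using 1(2) 2(2) by (auto simp: h_def)
    have ev1: "\<forall>\<^sub>F n in sequentially. \<forall>k. \<bar>real k * \<tau> n - h\<bar> \<le> \<tau> n \<longrightarrow>
        norm ((T n ^^ k) x - (x + h *\<^sub>R y)) \<le> \<epsilon> / 2 * h"
      using 1 h by (intro 1(3)) auto
    have ev2: "\<forall>\<^sub>F n in sequentially. \<forall>k. \<bar>real k * \<tau> n - h\<bar> \<le> \<tau> n \<longrightarrow>
        norm ((T n ^^ k) x - (x + h *\<^sub>R z)) \<le> \<epsilon> / 2 * h"
      using 2 h by (intro 2(3)) auto
    have "\<forall>\<^sub>F n in sequentially. norm (h *\<^sub>R y - h *\<^sub>R z) \<le> \<epsilon> * h"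
      using ev1 ev2 step_pos
    proof eventually_elim
      case (elim n)
      define k where "k = nat \<lfloor>h / \<tau> n\<rfloor>"
      have "\<bar>real k * \<tau> n - h\<bar> \<le> \<tau> n"
        using floor_steps[OF elim(3), of h] h(1) unfolding k_def by linarith
      with elim have "norm ((T n ^^ k) x - (x + h *\<^sub>R y)) \<le> \<epsilon> / 2 * h"
        "norm ((T n ^^ k) x - (x + h *\<^sub>R z)) \<le> \<epsilon> / 2 * h"
        by auto
      then show ?case
        using norm_triangle_ineq4[of "(T n ^^ k) x - (x + h *\<^sub>R z)" "(T n ^^ k) x - (x + h *\<^sub>R y)"]
        by simp
    qed
    then have "norm (h *\<^sub>R (y - z)) \<le> h * \<epsilon>"
      by (simp add: mult.commute[of h] scaleR_diff_right)
    then show ?thesis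
      using h(1) by simp
  qed
  then have "norm (y - z) \<le> 0"
    using field_le_epsilon[of "norm (y - z)" 0] by simp
  then show ?thesis by simp
qed

section \<open>Convergence of the scheme along a solution\<close>

theorem solution_tendsto:
  assumes sol: "\<And>r. r \<in> {0..<l} \<Longrightarrow> (f r, f' r) \<in> closure (consistent_graph T \<tau>)"
    and deriv: "\<And>r. r \<in> {0..<l} \<Longrightarrow> (f has_vector_derivative f' r) (at r within {0..<l})"
    and s: "s \<in> {0..<l}"
  shows "(\<lambda>n. (T n ^^ nat \<lfloor>s / \<tau> n\<rfloor>) (f 0)) \<longlonglongrightarrow> f s"
proof -
  \<comment> \<open>Discrete counterpart of following the solution up to time \<open>r\<close> and
    the semigroup for the remaining time \<open>s - r\<close>. At \<open>r = s\<close> this is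
    \<open>f s\<close>, at \<open>r = 0\<close> the scheme started from \<open>f 0\<close>.\<close>
  define \<phi> where "\<phi> n r = (T n ^^ nat \<lfloor>(s - r) / \<tau> n\<rfloor>) (f r)" for n r
  obtain C where C: "C \<ge> 1" "\<And>n k x. real k * \<tau> n \<le> s \<Longrightarrow> norm ((T n ^^ k) x) \<le> C * norm x"
    using stable[of s] by blast
  have main: "\<forall>\<^sub>F n in sequentially. norm (\<phi> n s - \<phi> n 0) \<le> \<epsilon> * (s - 0)" if "\<epsilon> > 0" for \<epsilon>
  proof -
    \<comment> \<open>The threshold for \<open>n\<close> may depend on the interval, since Bolzano's
      principle needs only the joining of adjacent intervals and small intervals around each point.
      Intervals leaving \<open>[0, s]\<close> satisfy \<open>P\<close> vacuously.\<close>
    define P where "P a b \<longleftrightarrow> (0 \<le> a \<and> b \<le> s \<longrightarrow>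
      (\<forall>\<^sub>F n in sequentially. norm (\<phi> n b - \<phi> n a) \<le> \<epsilon> * (b - a)))" for a b
    have P_trans: "P a c" if "P a b" "P b c" "a \<le> b" "b \<le> c" for a b c
      unfolding P_def
    proof
      assume ac: "0 \<le> a \<and> c \<le> s"
      with that have "\<forall>\<^sub>F n in sequentially. norm (\<phi> n b - \<phi> n a) \<le> \<epsilon> * (b - a)"
        "\<forall>\<^sub>F n in sequentially. norm (\<phi> n c - \<phi> n b) \<le> \<epsilon> * (c - b)"
        by (auto simp: P_def)
      then show "\<forall>\<^sub>F n in sequentially. norm (\<phi> n c - \<phi> n a) \<le> \<epsilon> * (c - a)"
      proof eventually_elim
        case (elim n)
        then show ?case
          using norm_triangle_ineq[of "\<phi> n b - \<phi> n a" "\<phi> n c - \<phi> n b"]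
          by (simp add: algebra_simps)
      qed
    qed
    \<comment> \<open>Both values of \<open>\<phi>\<close> end with the same \<open>m\<close> steps,
      which cost at most the factor \<open>C\<close>; hence the tolerance
      \<open>\<epsilon> / C\<close>. The other \<open>i - m\<close> steps take time
      \<open>b - a\<close> up to one step, because both floor remainders lie between 0 and
      \<open>\<tau> n\<close>.\<close>
    have P_step: "P a b"
      if ab: "a < b" and ev: "\<forall>\<^sub>F n in sequentially. \<forall>k. \<bar>real k * \<tau> n - (b - a)\<bar> \<le> \<tau> n \<longrightarrow>
        norm ((T n ^^ k) (f a) - f b) \<le> \<epsilon> / C * (b - a)" for a b
      unfolding P_def
    proof
      assume ab': "0 \<le> a \<and> b \<le> s"
      from ev step_pos show "\<forall>\<^sub>F n in sequentially. norm (\<phi> n b - \<phi> n a) \<le> \<epsilon> * (b - a)"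
      proof eventually_elim
        case (elim n)
        define i where "i = nat \<lfloor>(s - a) / \<tau> n\<rfloor>"
        define m where "m = nat \<lfloor>(s - b) / \<tau> n\<rfloor>"
        have mi: "m \<le> i"
          using ab elim(2) unfolding i_def m_def
          by (intro nat_mono floor_mono divide_right_mono) auto
        have i: "real i * \<tau> n \<le> s - a" "s - a < real i * \<tau> n + \<tau> n"
          and m: "real m * \<tau> n \<le> s - b" "s - b < real m * \<tau> n + \<tau> n"
          using floor_steps[OF elim(2), of "s - a"] floor_steps[OF elim(2), of "s - b"] ab ab'
          by (auto simp: i_def m_def)
        have "\<bar>real (i - m) * \<tau> n - (b - a)\<bar> \<le> \<tau> n"
          using mi i m by (simp add: of_nat_diff left_diff_distrib)
        with elim have e: "norm ((T n ^^ (i - m)) (f a) - f b) \<le> \<epsilon> / C * (b - a)"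
          by blast
        have "(T n ^^ i) (f a) = (T n ^^ m) ((T n ^^ (i - m)) (f a))"
          using mi funpow_add[of m "i - m" "T n"] by simp
        then have "\<phi> n a - \<phi> n b = (T n ^^ m) ((T n ^^ (i - m)) (f a) - f b)"
          by (simp add: \<phi>_def i_def m_def linear_diff[OF linear_power])
        then have "norm (\<phi> n b - \<phi> n a) \<le> C * norm ((T n ^^ (i - m)) (f a) - f b)"
          using C(2)[of m n] m ab ab' by (simp add: norm_minus_commute[of "\<phi> n b"])
        also have "\<dots> \<le> C * (\<epsilon> / C * (b - a))"
          using e C(1) by (intro mult_left_mono) auto
        finally show ?case
          using C(1) by simp
      qed
    qed
    have "P 0 s"
    proof (rule Bolzano)
      show "0 \<le> s" using s by simp
    next
      fix a b c assume "P a b" "P b c" "a \<le> b" "b \<le> c"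
      then show "P a c" by (rule P_trans)
    next
      fix r assume r: "0 \<le> r" "r \<le> s"
      then have rl: "r \<in> {0..<l}" using s by simp
      have "\<epsilon> / C > 0" using \<open>\<epsilon> > 0\<close> C(1) by simp
      from local_error[OF sol[OF rl] this] obtain c \<delta> where c: "c > 0" and \<delta>: "\<delta> > 0"
        and fwd: "\<And>h z. 0 < h \<Longrightarrow> h < \<delta> \<Longrightarrow> norm (z - f r - h *\<^sub>R f' r) \<le> c * h \<Longrightarrow>
          \<forall>\<^sub>F n in sequentially. \<forall>k. \<bar>real k * \<tau> n - h\<bar> \<le> \<tau> n \<longrightarrow>
            norm ((T n ^^ k) (f r) - z) \<le> \<epsilon> / C * h"
        and bwd: "\<And>h z. 0 < h \<Longrightarrow> h < \<delta> \<Longrightarrow> norm (f r - z - h *\<^sub>R f' r) \<le> c * h \<Longrightarrow>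
          \<forall>\<^sub>F n in sequentially. \<forall>k. \<bar>real k * \<tau> n - h\<bar> \<le> \<tau> n \<longrightarrow>
            norm ((T n ^^ k) z - f r) \<le> \<epsilon> / C * h"
        by blast
      \<comment> \<open>Differentiability at \<open>r\<close> bounds the defect of \<open>f\<close>
        on both sides of \<open>r\<close> by the constant \<open>c\<close> that
        \<open>local_error\<close> asks for.\<close>
      obtain d where d: "d > 0" "\<And>q. q \<in> {0..<l} \<Longrightarrow> \<bar>q - r\<bar> < d \<Longrightarrow>
          norm (f q - f r - (q - r) *\<^sub>R f' r) \<le> c * \<bar>q - r\<bar>"
        using deriv[OF rl] c
        unfolding has_vector_derivative_def has_derivative_within_alt real_norm_def by blast
      \<comment> \<open>An interval around \<open>r\<close> is cut at \<open>r\<close>, so that the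
        expansion is always taken at \<open>f r\<close>: forwards to the right of \<open>r\<close>,
        backwards to the left.\<close>
      have right: "P r b" if "r \<le> b" "b - r < min d \<delta>" for b
      proof (cases "r = b \<or> b > s")
        case True
        then show ?thesis by (auto simp: P_def)
      next
        case False
        with that r s d(2)[of b] show ?thesis
          by (intro P_step fwd) auto
      qed
      have left: "P a r" if "a \<le> r" "r - a < min d \<delta>" for a
      proof (cases "a = r \<or> a < 0")
        case True
        then show ?thesis by (auto simp: P_def)
      next
        case False
        then have "norm (f a - f r - (a - r) *\<^sub>R f' r) \<le> c * (r - a)"
          using that r rl d(2)[of a] by auto
        moreover have "norm (f r - f a - (r - a) *\<^sub>R f' r) = norm (f a - f r - (a - r) *\<^sub>R f' r)"
          using norm_minus_cancel[of "f a - f r - (a - r) *\<^sub>R f' r"] by (simp add: algebra_simps)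
        ultimately show ?thesis
          using False that by (intro P_step bwd) auto
      qed
      show "\<exists>d>0. \<forall>a b. a \<le> r \<and> r \<le> b \<and> b - a < d \<longrightarrow> P a b"
      proof (intro exI[of _ "min d \<delta>"] conjI allI impI)
        show "0 < min d \<delta>"
          using d(1) \<delta> by simp
        fix a b assume "a \<le> r \<and> r \<le> b \<and> b - a < min d \<delta>"
        then show "P a b"
          by (intro P_trans[OF left right]) auto
      qed
    qed
    then show ?thesis
      using s by (simp add: P_def)
  qed
  have \<phi>s: "\<phi> n s = f s" for n
    by (simp add: \<phi>_def)
  show ?thesis
  proof (rule tendstoI)
    fix e :: real assume "e > 0"
    \<comment> \<open>The denominator \<open>s + 1\<close> includes the case
      \<open>s = 0\<close>.\<close>
    have "e / (s + 1) * s < e"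
      using s \<open>e > 0\<close> by (simp add: field_simps)
    moreover have "\<forall>\<^sub>F n in sequentially. norm (\<phi> n s - \<phi> n 0) \<le> e / (s + 1) * s"
      using main[of "e / (s + 1)"] \<open>e > 0\<close> s by simp
    ultimately have "\<forall>\<^sub>F n in sequentially. norm (f s - \<phi> n 0) < e"
      unfolding \<phi>s by (auto elim!: eventually_mono)
    then show "\<forall>\<^sub>F n in sequentially. dist ((T n ^^ nat \<lfloor>s / \<tau> n\<rfloor>) (f 0)) (f s) < e"
      by (simp add: \<phi>_def dist_norm norm_minus_commute)
  qed
qed

end

section \<open>From the class of operator families to a stable scheme\<close>

lemma bounded_operator_imp_bounded_linear:
  assumes "banach_space_over smul" "bounded_operator smul smul' A"
    and "\<And>r y. smul' (of_real r) y = r *\<^sub>R y"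
  shows "bounded_linear A"
proof -
  interpret banach_space_over smul by fact
  interpret A: Vector_Spaces.linear smul smul' A
    using assms(2) by (simp add: bounded_operator_def)
  obtain B where "\<And>x. norm (A x) \<le> B * norm x"
    using assms(2) by (auto simp: bounded_operator_def)
  then show ?thesis
    by (intro bounded_linear_intro[of A B])
      (auto simp: A.add A.scale assms(3) mult.commute simp flip: scale_of_real)
qed

lemma bounded_linear_power:
  fixes A :: "'a \<Rightarrow> 'a::real_normed_vector"
  assumes "bounded_linear A"
  shows "bounded_linear (A ^^ m)"
proof (induction m)
  case 0
  show ?case unfolding funpow.simps id_def by (rule bounded_linear_ident)
next
  case (Suc m)
  then show ?case
    using bounded_linear_compose[OF assms] by (simp add: o_def)
qed

lemma deriv0_consistent:
  assumes "x \<in> deriv0_dom S" "S 0 = id" "\<And>n. 0 \<le> \<tau> n"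
    and "\<forall>\<^sub>F n in sequentially. \<tau> n > 0" "\<tau> \<longlonglongrightarrow> 0"
  shows "(x, deriv0 S x) \<in> consistent_graph (\<lambda>n. S (\<tau> n)) \<tau>"
proof -
  obtain L where L: "((\<lambda>h. (1 / h) *\<^sub>R (S h x - S 0 x)) \<longlongrightarrow> L) (at_right 0)"
    using assms(1) by (auto simp: deriv0_dom_def)
  then have "deriv0 S x = L"
    unfolding deriv0_def by (intro tendsto_Lim) auto
  have "filterlim \<tau> (at_right 0) sequentially"
    unfolding filterlim_at using assms(4,5) by (auto elim: eventually_mono)
  from filterlim_compose[OF L this]
  have lim: "(\<lambda>n. (1 / \<tau> n) *\<^sub>R (S (\<tau> n) x - x)) \<longlonglongrightarrow> L"
    by (simp add: assms(2))
  have "\<forall>\<^sub>F n in sequentially. norm (S (\<tau> n) x - x - \<tau> n *\<^sub>R L) \<le> \<epsilon> * \<tau> n" if "\<epsilon> > 0" for \<epsilon>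
    using tendstoD[OF lim that] assms(4)
  proof eventually_elim
    case (elim n)
    have "S (\<tau> n) x - x - \<tau> n *\<^sub>R L = \<tau> n *\<^sub>R ((1 / \<tau> n) *\<^sub>R (S (\<tau> n) x - x) - L)"
      using elim(2) by (simp add: scaleR_diff_right)
    then have "norm (S (\<tau> n) x - x - \<tau> n *\<^sub>R L) = \<tau> n * dist ((1 / \<tau> n) *\<^sub>R (S (\<tau> n) x - x)) L"
      using elim(2) by (simp add: dist_norm)
    then show ?case
      using elim by (simp add: mult.commute mult_left_mono)
  qed
  then show ?thesis
    unfolding \<open>deriv0 S x = L\<close> by (simp add: consistent_graph_def)
qed

text \<open>With \<open>s = t\<close> the exponential bound depends on \<open>n\<close> and
  \<open>m\<close> only through the elapsed time \<open>m * t / n\<close>, so it is uniform on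
  bounded times. Density passes from the domain of the derivative at 0 to the larger domain of the
  consistent graph.\<close>

lemma class_F_stable_scheme:
  assumes X: "banach_space_over smul" and F: "F \<in> class_F smul" and t: "t > 0"
  shows "stable_scheme (\<lambda>n. F (t / real n)) (\<lambda>n. t / real n)"
proof -
  have bl: "bounded_linear (F s)" if "s \<ge> 0" for s
    using F that X
    by (intro bounded_operator_imp_bounded_linear[OF X])
      (auto simp: class_F_def banach_space_over.scale_of_real)
  have F0: "F 0 = id"
    using F by (simp add: class_F_def)
  have lin: "linear (F (t / real n))" for n
    using bl[of "t / real n"] t by (simp add: bounded_linear.linear)
  have nonneg: "0 \<le> t / real n" for n
    using t by simp
  have pos: "\<forall>\<^sub>F n in sequentially. 0 < t / real n"
    using eventually_gt_at_top[of 0] by eventually_elim (use t in simp)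
  have lim: "(\<lambda>n. t / real n) \<longlonglongrightarrow> 0"
    by (rule lim_const_over_n)
  obtain M a where M: "M \<ge> 1" "\<And>n m s. n \<ge> 1 \<Longrightarrow> m \<ge> 1 \<Longrightarrow> s \<ge> 0 \<Longrightarrow>
      onorm (F (s / real n) ^^ m) \<le> M * exp (a * real m / real n * s)"
    using F unfolding class_F_def by blast
  have stab: "\<exists>C\<ge>1. \<forall>n k x. real k * (t / real n) \<le> B \<longrightarrow>
      norm ((F (t / real n) ^^ k) x) \<le> C * norm x" for B
  proof (intro exI conjI allI impI)
    have ge1: "1 \<le> M * exp (\<bar>a\<bar> * \<bar>B\<bar>)"
      using mult_mono[of 1 M 1 "exp (\<bar>a\<bar> * \<bar>B\<bar>)"] M(1) by simp
    then show "1 \<le> M * exp (\<bar>a\<bar> * \<bar>B\<bar>)" .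
    fix n k x assume k: "real k * (t / real n) \<le> B"
    show "norm ((F (t / real n) ^^ k) x) \<le> M * exp (\<bar>a\<bar> * \<bar>B\<bar>) * norm x"
    \<comment> \<open>The growth bound concerns \<open>n\<close> and \<open>m\<close> from 1 on. For
      \<open>n = 0\<close> the step is \<open>F 0\<close>, the identity, as is the power for
      \<open>k = 0\<close>; a constant of at least 1 covers both.\<close>
    proof (cases "n = 0 \<or> k = 0")
      case True
      then have "(F (t / real n) ^^ k) x = x"
        using F0 by auto
      then show ?thesis
        using mult_right_mono[OF ge1, of "norm x"] by simp
    next
      case False
      have "norm ((F (t / real n) ^^ k) x) \<le> onorm (F (t / real n) ^^ k) * norm x"
        by (intro onorm bounded_linear_power bl nonneg)
      also have "\<dots> \<le> M * exp (a * real k / real n * t) * norm x"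
        using False t by (intro mult_right_mono M(2)) auto
      also have "a * real k / real n * t = a * (real k * (t / real n))"
        by simp
      also have "M * exp (a * (real k * (t / real n))) * norm x \<le> M * exp (\<bar>a\<bar> * \<bar>B\<bar>) * norm x"
      proof -
        have "a * (real k * (t / real n)) \<le> \<bar>a\<bar> * (real k * (t / real n))"
          using t by (intro mult_right_mono) auto
        also have "\<dots> \<le> \<bar>a\<bar> * \<bar>B\<bar>"
          using k by (intro mult_left_mono) auto
        finally show ?thesis
          using M(1) by (intro mult_right_mono mult_left_mono) auto
      qed
      finally show ?thesis .
    qed
  qed
  have "deriv0_dom F \<subseteq> Domain (consistent_graph (\<lambda>n. F (t / real n)) (\<lambda>n. t / real n))"
    using deriv0_consistent[where S = F and \<tau> = "\<lambda>n. t / real n", OF _ F0 nonneg pos lim] by blast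
  from closure_mono[OF this]
  have "closure (Domain (consistent_graph (\<lambda>n. F (t / real n)) (\<lambda>n. t / real n))) = UNIV"
    using F by (auto simp: class_F_def)
  then show ?thesis
    by (intro stable_scheme.intro lin nonneg pos lim stab)
qed

section \<open>Passage to the weak topology, and the Cauchy problem for the closure\<close>

lemma limitin_weak_topology:
  fixes smul :: "'k::real_normed_field \<Rightarrow> 'a::banach \<Rightarrow> 'a"
  assumes X: "banach_space_over smul" and "x \<longlonglongrightarrow> y"
  shows "limitin (weak_topology smul) x y sequentially"
proof -
  let ?B = "{\<phi> -` U |\<phi> U. bounded_operator smul ((*) :: 'k \<Rightarrow> 'k \<Rightarrow> 'k) \<phi> \<and> open U}"
  \<comment> \<open>Norm convergence is carried over by continuity of the identity from the norm
    topology to the weak one, checked on the generating sets.\<close>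
  have "continuous_map euclidean (weak_topology smul) id"
    unfolding weak_topology_def
  proof (rule continuous_on_generated_topo)
    fix V assume "V \<in> ?B"
    then obtain \<phi> :: "'a \<Rightarrow> 'k" and U where V: "V = \<phi> -` U" "bounded_operator smul (*) \<phi>" "open U"
      by blast
    have "bounded_linear \<phi>"
      using bounded_operator_imp_bounded_linear[OF X V(2)] by (simp add: scaleR_conv_of_real)
    then have "continuous_on UNIV \<phi>"
      by (rule linear_continuous_on)
    then show "openin euclidean (id -` V \<inter> topspace euclidean)"
      using V by (simp add: open_vimage)
  next
    interpret banach_space_over smul by fact
    interpret K: vector_space "(*) :: 'k \<Rightarrow> 'k \<Rightarrow> 'k"
      by unfold_locales (auto simp: algebra_simps)
    \<comment> \<open>The preimage of the whole field under the zero functional shows that the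
      generating sets cover the space.\<close>
    have "bounded_operator smul ((*) :: 'k \<Rightarrow> 'k \<Rightarrow> 'k) (\<lambda>_. 0)"
      unfolding bounded_operator_def by (intro conjI exI[of _ 0]) (unfold_locales, auto)
    then have "(\<lambda>_. 0) -` UNIV \<in> ?B"
      by blast
    then show "id ` topspace euclidean \<subseteq> \<Union> ?B"
      by auto
  qed
  from continuous_map_limit[OF this] assms(2) show ?thesis
    by (simp add: o_def)
qed

theorem theorem4p1:
  fixes smul :: "'k::real_normed_field \<Rightarrow> 'a::banach \<Rightarrow> 'a"
    and F :: "real \<Rightarrow> 'a \<Rightarrow> 'a"
    and t l :: real
    and D :: "'a set"
    and Z :: "'a \<Rightarrow> 'a"
    and f :: "real \<Rightarrow> 'a"
    and g :: 'a
  assumes "banach_space_over smul"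
    and "F \<in> class_F smul"
    and "t > 0" and "l > 0"
    and "linear_operator_on smul D Z"
    and "D \<subseteq> deriv0_dom F"
    and "\<forall>x\<in>D. Z x = deriv0 F x"
    and "g \<in> op_closure_dom D Z"
    and "local_solution (op_closure_dom D Z) (op_closure D Z) l g f"
  shows "(\<forall>u. local_solution (op_closure_dom D Z) (op_closure D Z) l g u \<longrightarrow>
            (\<forall>s\<in>{0..<l}. u s = f s)) \<and>
         (\<forall>s\<in>{0..<l}. limitin (weak_topology smul)
            (\<lambda>n. (F (t / real n) ^^ nat \<lfloor>real n * s / t\<rfloor>) g) (f s) sequentially)"
proof -
  interpret stable_scheme "\<lambda>n. F (t / real n)" "\<lambda>n. t / real n"
    using assms(1-3) by (rule class_F_stable_scheme)
  let ?K = "consistent_graph (\<lambda>n. F (t / real n)) (\<lambda>n. t / real n)"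
  have "F 0 = id"
    using assms(2) by (simp add: class_F_def)
  then have "op_graph D Z \<subseteq> ?K"
    using deriv0_consistent[OF _ _ step_nonneg step_pos step_tendsto, of _ F] assms(6,7)
    by (auto simp: op_graph_def subset_iff)
  then have sub: "closure (op_graph D Z) \<subseteq> closure ?K"
    by (rule closure_mono)
  \<comment> \<open>By \<open>closable\<close> the closed graph is single-valued, so the description
    in \<open>op_closure\<close> denotes the actual value.\<close>
  have graph: "(x, op_closure D Z x) \<in> closure ?K" if x: "x \<in> op_closure_dom D Z" for x
  proof -
    obtain y where y: "(x, y) \<in> closure (op_graph D Z)"
      using x by (auto simp: op_closure_dom_def)
    then have "op_closure D Z x = y"
      unfolding op_closure_def using sub by (blast intro: the_equality closable)
    with y sub show ?thesis by blast
  qed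
  \<comment> \<open>Stated for an arbitrary solution: the approximants depend on \<open>g\<close>
    alone, so two solutions are limits of the same sequence.\<close>
  have lim: "(\<lambda>n. (F (t / real n) ^^ nat \<lfloor>real n * s / t\<rfloor>) g) \<longlonglongrightarrow> u s"
    if u: "local_solution (op_closure_dom D Z) (op_closure D Z) l g u" and s: "s \<in> {0..<l}" for u s
  proof -
    have "(\<lambda>n. (F (t / real n) ^^ nat \<lfloor>s / (t / real n)\<rfloor>) (u 0)) \<longlonglongrightarrow> u s"
      using u by (intro solution_tendsto[OF graph _ s]) (auto simp: local_solution_def)
    moreover have "u 0 = g"
      using u by (simp add: local_solution_def)
    ultimately show ?thesis
      by (simp add: mult.commute)
  qed
  show ?thesis
  proof (intro conjI ballI allI impI)
    fix u s
    assume "local_solution (op_closure_dom D Z) (op_closure D Z) l g u" "s \<in> {0..<l}"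
    then show "u s = f s"
      using LIMSEQ_unique[OF lim lim[OF assms(9)]] by blast
  next
    fix s assume "s \<in> {0..<l}"
    then show "limitin (weak_topology smul)
        (\<lambda>n. (F (t / real n) ^^ nat \<lfloor>real n * s / t\<rfloor>) g) (f s) sequentially"
      by (intro limitin_weak_topology[OF assms(1)] lim[OF assms(9)])
  qed
qed

end
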